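(* Let $W$ be a Coxeter group, and let $c$ be a Coxeter element of $W$. The following are equivalent. (i) Every nonempty convex set $\mathscr L\subseteq W$ is heavy with respect to $c$. (ii) Every nonempty finite convex set $\mathscr L\subseteq W$ is heavy with respect to $c$. (iii) Every nonempty finite convex set $\mathscr L\subseteq W$ is superheavy with respect to $c$.
   Context: Let $(W,S)$ be a Coxeter system with $S=\{s_i:i\in I\}$, $I$ a finite index set; $m(i,i')$ is the order of $s_is_{i'}$. The root space is $V=\mathbb R^I$ with standard basis the simple roots $\{\alpha_i:i\in I\}$ and symmetric bilinear form $B(\alpha_i,\alpha_{i'})=-\cos(\pi/m(i,i'))$ (and $-1$ if $m(i,i')=\infty$). $W$ acts on $V$ by $s_i\beta=\beta-2B(\beta,\alpha_i)\alpha_i$. The root system is $\Phi=\{w\alpha_i:w\in W,i\in I\}=\Phi^+\sqcup\Phi^-$, where $\Phi^+$ are the roots that are nonnegative combinations of simple roots and $\Phi^-=-\Phi^+$. For $\beta\in\Phi$ the half-space $H_\beta^+$ is $\{w\in W:w\beta\in\Phi^+\}$. A subset of $W$ is convex if it is an intersection of half-spaces (the empty intersection being $W$). For a nonempty convex set $\mathscr L\subseteq W$ let $\mathrm R(\mathscr L)=\{\beta\in\Phi:\mathscr L\subseteq H_\beta^+\}$. For $i\in I$, the toggle $\tau_i\colon W\to W$ is defined by $\tau_i(u)=u$ if $u^{-1}\alpha_i\in\mathrm R(\mathscr L)$ and $\tau_i(u)=s_iu$ otherwise. A Coxeter element is a product $c=s_{i_n}\cdots s_{i_1}$ where $i_1,\ldots,i_n$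 is an ordering of $I$ (each element once); $\mathrm{Pro}_c=\tau_{i_n}\cdots\tau_{i_1}$ (composition), which depends only on $c$ and $\mathscr L$. With $\mathrm{Pro}_c$ defined with respect to $\mathscr L$: the set $\mathscr L$ is heavy with respect to $c$ if every periodic point of $\mathrm{Pro}_c$ (i.e. every $u\in W$ with $\mathrm{Pro}_c^K(u)=u$ for some $K\ge 1$) lies in $\mathscr L$; it is superheavy with respect to $c$ if for every $u\in W$ there is an integer $K\ge 0$ with $\mathrm{Pro}_c^K(u)\in\mathscr L$. *)

theory Defs
  imports
    Complex_Main
    "HOL-Algebra.Generated_Groups"
    "HOL-Algebra.Multiplicative_Group"
begin

section \<open>Coxeter systems\<close>

text \<open>
  A generating family of a group \<open>W\<close> is given by a finite index set \<open>I\<close> and a function \<open>s\<close>.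
  The list \<open>[i, j, ...]\<close> stands for the word \<open>s i \<otimes> s j \<otimes> ...\<close>.
\<close>

definition word_prod :: "('g, 'b) monoid_scheme \<Rightarrow> ('i \<Rightarrow> 'g) \<Rightarrow> 'i list \<Rightarrow> 'g" where
  "word_prod W s xs = foldr (\<lambda>i w. s i \<otimes>\<^bsub>W\<^esub> w) xs \<one>\<^bsub>W\<^esub>"

text \<open>
  The order of \<open>s i \<otimes> s j\<close>. As for \<^const>\<open>group.ord\<close> in general, the value 0 encodes infinite order.
\<close>

definition cox_order :: "('g, 'b) monoid_scheme \<Rightarrow> ('i \<Rightarrow> 'g) \<Rightarrow> 'i \<Rightarrow> 'i \<Rightarrow> nat" where
  "cox_order W s i j = group.ord W (s i \<otimes>\<^bsub>W\<^esub> s j)"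

text \<open>
  Deletion of one relator \<open>(i j)\<^sup>m\<close>, where \<open>m\<close> is the order of \<open>s i \<otimes> s j\<close>. If that order is infinite
  the relator is the empty word, so no relation is imposed.
\<close>

inductive relator_step ::
  "('g, 'b) monoid_scheme \<Rightarrow> 'i set \<Rightarrow> ('i \<Rightarrow> 'g) \<Rightarrow> 'i list \<Rightarrow> 'i list \<Rightarrow> bool"
  for W I s where
  "i \<in> I \<Longrightarrow> j \<in> I \<Longrightarrow>
     relator_step W I s (xs @ concat (replicate (cox_order W s i j) [i, j]) @ ys) (xs @ ys)"

text \<open>
  The last assumption says that all relations between the generators follow from the relations
  \<open>(s i \<otimes> s j)\<^sup>m = \<one>\<close>; together with generation this is the presentation of \<open>W\<close>. Words in the
  generators alone suffice, without formal inverses, because \<open>i = j\<close> yields the relator \<open>[i, i]\<close>.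
\<close>

locale coxeter_system = group W
  for W :: "('g, 'b) monoid_scheme" (structure) and I :: "'i set" and s :: "'i \<Rightarrow> 'g" +
  assumes finite_index: "finite I"
    and gen_closed: "i \<in> I \<Longrightarrow> s i \<in> carrier W"
    and gen_inj: "inj_on s I"
    and gen_nontrivial: "i \<in> I \<Longrightarrow> s i \<noteq> \<one>"
    and gen_involution: "i \<in> I \<Longrightarrow> s i \<otimes> s i = \<one>"
    and gen_generate: "generate W (s ` I) = carrier W"
    and presentation: "\<lbrakk>xs \<in> lists I; ys \<in> lists I; word_prod W s xs = word_prod W s ys\<rbrakk>
      \<Longrightarrow> equivclp (relator_step W I s) xs ys"
begin

section \<open>Root space and root system\<close>

text \<open>
  The root space \<open>\<real>\<^sup>I\<close> is represented by functions \<open>'i \<Rightarrow> real\<close>. All vectors that matter (the roots)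
  vanish outside \<open>I\<close>.
\<close>

definition simple_root :: "'i \<Rightarrow> 'i \<Rightarrow> real" where
  "simple_root i = (\<lambda>j. if j = i then 1 else 0)"

definition gram :: "'i \<Rightarrow> 'i \<Rightarrow> real" where
  "gram i j = (if cox_order W s i j = 0 then - 1 else - cos (pi / real (cox_order W s i j)))"

definition bform :: "('i \<Rightarrow> real) \<Rightarrow> ('i \<Rightarrow> real) \<Rightarrow> real" where
  "bform u v = (\<Sum>i\<in>I. \<Sum>j\<in>I. u i * v j * gram i j)"

definition reflect :: "'i \<Rightarrow> ('i \<Rightarrow> real) \<Rightarrow> ('i \<Rightarrow> real)" where
  "reflect i v = (\<lambda>j. v j - 2 * bform v (simple_root i) * simple_root i j)"

text \<open>
  The action of \<open>w\<close> is the composite of the simple reflections along a word for \<open>w\<close>. The choice of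
  the word is immaterial, since the simple reflections satisfy the relations of \<open>W\<close>.
\<close>

definition act :: "'g \<Rightarrow> ('i \<Rightarrow> real) \<Rightarrow> ('i \<Rightarrow> real)" where
  "act w = foldr reflect (SOME xs. xs \<in> lists I \<and> word_prod W s xs = w)"

definition roots :: "('i \<Rightarrow> real) set" where
  "roots = {act w (simple_root i) | w i. w \<in> carrier W \<and> i \<in> I}"

definition pos_roots :: "('i \<Rightarrow> real) set" where
  "pos_roots = {\<beta> \<in> roots. \<forall>i\<in>I. 0 \<le> \<beta> i}"

section \<open>Convex sets\<close>

definition half_space :: "('i \<Rightarrow> real) \<Rightarrow> 'g set" where
  "half_space \<beta> = {w \<in> carrier W. act w \<beta> \<in> pos_roots}"

text \<open>Intersecting with the carrier makes the empty intersection the whole group.\<close>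

definition convex_subset :: "'g set \<Rightarrow> bool" where
  "convex_subset L \<longleftrightarrow> (\<exists>A \<subseteq> roots. L = carrier W \<inter> (\<Inter>\<beta>\<in>A. half_space \<beta>))"

definition root_constraints :: "'g set \<Rightarrow> ('i \<Rightarrow> real) set" where
  "root_constraints L = {\<beta> \<in> roots. L \<subseteq> half_space \<beta>}"

section \<open>Toggles and Bender--Knuth promotion\<close>

definition toggle :: "'g set \<Rightarrow> 'i \<Rightarrow> 'g \<Rightarrow> 'g" where
  "toggle L i u =
     (if act (inv u) (simple_root i) \<in> root_constraints L then u else s i \<otimes> u)"

text \<open>
  Words are read from left to right, so \<open>c = s\<^sub>i\<^sub>n \<cdots> s\<^sub>i\<^sub>1\<close> corresponds to the list \<open>[i\<^sub>n, \<dots>, i\<^sub>1]\<close>.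
\<close>

definition coxeter_word :: "'g \<Rightarrow> 'i list \<Rightarrow> bool" where
  "coxeter_word c xs \<longleftrightarrow> distinct xs \<and> set xs = I \<and> word_prod W s xs = c"

definition coxeter_element :: "'g \<Rightarrow> bool" where
  "coxeter_element c \<longleftrightarrow> (\<exists>xs. coxeter_word c xs)"

text \<open>
  For the list \<open>[i\<^sub>n, \<dots>, i\<^sub>1]\<close>, \<^const>\<open>foldr\<close> applies the toggle of \<open>i\<^sub>1\<close> first and that of \<open>i\<^sub>n\<close> last.
  The choice of the word is immaterial: any two orderings of \<open>I\<close> with product \<open>c\<close> differ by
  transpositions of adjacent commuting letters, and the corresponding toggles commute.
\<close>

definition Pro :: "'g \<Rightarrow> 'g set \<Rightarrow> 'g \<Rightarrow> 'g" where
  "Pro c L = foldr (toggle L) (SOME xs. coxeter_word c xs)"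

definition heavy :: "'g \<Rightarrow> 'g set \<Rightarrow> bool" where
  "heavy c L \<longleftrightarrow> (\<forall>u\<in>carrier W. (\<exists>K\<ge>1. (Pro c L ^^ K) u = u) \<longrightarrow> u \<in> L)"

definition superheavy :: "'g \<Rightarrow> 'g set \<Rightarrow> bool" where
  "superheavy c L \<longleftrightarrow> (\<forall>u\<in>carrier W. \<exists>K. (Pro c L ^^ K) u \<in> L)"

end

end

theory Submission
  imports Defs
begin

text \<open>
  A toggle never crosses a wall of a constraint of \<open>L\<close> outwards, so an orbit of promotion
  that has entered \<open>L\<close> stays there; this makes superheavy sets heavy. For the converse, only
  finitely many roots separate two elements of a finite \<open>L\<close>, and every other root is a constraint
  up to sign. The constraints violated along an orbit are among those violated at its start, so
  the orbit is finite, hence reaches a periodic point. Finally, a periodic orbit for an arbitrary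
  convex \<open>L\<close> depends on finitely many elements of \<open>L\<close> only, and the convex hull of these is finite.

  The facts on Coxeter groups behind this are that each root is positive or negative and that the
  finite set of roots separating two elements is empty only if the elements are equal.
\<close>

section \<open>Alternating words and the Chebyshev recursion\<close>

text \<open>Chebyshev polynomials of the second kind with the index shifted:
  \<open>cheb x (Suc n)\<close> is the classical U_n(x). They serve as the coordinates of a simple
  root under alternating reflections.\<close>

fun cheb :: "real \<Rightarrow> nat \<Rightarrow> real" where
  "cheb x 0 = 0"
| "cheb x (Suc 0) = 1"
| "cheb x (Suc (Suc n)) = 2 * x * cheb x (Suc n) - cheb x n"

lemma cheb_one: "cheb 1 n = real n"
  by (induction "1::real" n rule: cheb.induct) auto

lemma sin_mult_cheb_cos: "sin t * cheb (cos t) n = sin (real n * t)"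
proof (induction "cos t" n rule: cheb.induct)
  case (3 n)
  have "sin t * cheb (cos t) (Suc (Suc n))
      = 2 * cos t * (sin t * cheb (cos t) (Suc n)) - sin t * cheb (cos t) n"
    by (simp add: algebra_simps)
  also have "\<dots> = 2 * cos t * sin (real (Suc n) * t) - sin (real n * t)"
    using 3 by simp
  also have "\<dots> = sin (real (Suc (Suc n)) * t)"
  proof -
    have "sin (real (Suc (Suc n)) * t) = sin (real (Suc n) * t + t)"
      "sin (real n * t) = sin (real (Suc n) * t - t)"
      by (simp_all add: algebra_simps)
    then show ?thesis
      unfolding sin_add sin_diff by simp
  qed
  finally show ?case .
qed auto

text \<open>The right end is fixed: every nonempty word ends in \<open>b\<close> and grows on the
  left. This fits \<open>foldr\<close>, which applies the rightmost reflection first.\<close>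

primrec altw :: "'i \<Rightarrow> 'i \<Rightarrow> nat \<Rightarrow> 'i list" where
  "altw a b 0 = []"
| "altw a b (Suc k) = (if even k then b else a) # altw a b k"

lemma length_altw [simp]: "length (altw a b k) = k"
  by (induction k) auto

lemma altw_in_lists: "a \<in> A \<Longrightarrow> b \<in> A \<Longrightarrow> altw a b k \<in> lists A"
  by (induction k) auto

lemma altw_Suc_right: "altw a b (Suc k) = altw b a k @ [b]"
  by (induction k) auto

lemma altw_add: "\<exists>xs. altw a b (k + n) = xs @ altw a b n \<and> length xs = k \<and> set xs \<subseteq> {a, b}"
proof (induction k)
  case (Suc k)
  then obtain xs where "altw a b (k + n) = xs @ altw a b n" "length xs = k" "set xs \<subseteq> {a, b}"
    by blast
  then show ?case
    by (intro exI[of _ "(if even (k + n) then b else a) # xs"]) auto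
qed auto

lemma altw_even: "altw a b (2 * m) = concat (replicate m [a, b])"
  by (induction m) auto

lemma funpow_orbit_finite_periodic:
  assumes "finite Z" "\<And>n. (f ^^ n) u \<in> Z"
  obtains n K where "K \<ge> 1" "(f ^^ K) ((f ^^ n) u) = (f ^^ n) u"
proof -
  have "finite (range (\<lambda>n. (f ^^ n) u))"
    using assms by (auto intro: finite_subset)
  then have "\<not> inj (\<lambda>n. (f ^^ n) u)"
    using range_inj_infinite by blast
  then obtain a b where "(f ^^ a) u = (f ^^ b) u" "a < b"
    unfolding inj_def by (metis linorder_neqE_nat)
  then have "(f ^^ (b - a)) ((f ^^ a) u) = (f ^^ a) u"
    by (metis comp_apply funpow_add le_add_diff_inverse2 less_imp_le)
  then show ?thesis
    using that[of "b - a" a] \<open>a < b\<close> by auto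
qed

context coxeter_system
begin

section \<open>The bilinear form and the reflections\<close>

abbreviation wp :: "'i list \<Rightarrow> 'g" where "wp \<equiv> word_prod W s"

lemma wp_simps [simp]: "wp [] = \<one>" "wp (i # xs) = s i \<otimes> wp xs"
  by (auto simp: word_prod_def)

lemma wp_closed [simp]: "xs \<in> lists I \<Longrightarrow> wp xs \<in> carrier W"
  by (induction xs) (auto simp: gen_closed)

lemma wp_append: "xs \<in> lists I \<Longrightarrow> ys \<in> lists I \<Longrightarrow> wp (xs @ ys) = wp xs \<otimes> wp ys"
  by (induction xs) (auto simp: gen_closed m_assoc)

lemma gen_inv: "i \<in> I \<Longrightarrow> inv (s i) = s i"
  using gen_involution gen_closed inv_equality by blast

lemma word_exists:
  assumes "w \<in> carrier W"
  shows "\<exists>xs \<in> lists I. wp xs = w"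
proof -
  have "w \<in> generate W (s ` I)"
    using assms gen_generate by simp
  then show ?thesis
  proof (induction rule: generate.induct)
    case one
    then show ?case by (intro bexI[of _ "[]"]) auto
  next
    case (incl h)
    then obtain i where "i \<in> I" "h = s i" by auto
    then show ?case by (intro bexI[of _ "[i]"]) (auto simp: gen_closed)
  next
    case (inv h)
    then obtain i where "i \<in> I" "h = s i" by auto
    then show ?case by (intro bexI[of _ "[i]"]) (auto simp: gen_closed gen_inv)
  next
    case (eng h1 h2)
    then show ?case using wp_append by (metis append_in_lists_conv)
  qed
qed

lemma cox_order_sym:
  assumes "i \<in> I" "j \<in> I"
  shows "cox_order W s i j = cox_order W s j i"
proof -
  have "inv (s i \<otimes> s j) = s j \<otimes> s i"
    using assms by (simp add: inv_mult_group gen_inv gen_closed)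
  then show ?thesis
    using assms gen_closed unfolding cox_order_def by (metis m_closed ord_inv)
qed

lemma cox_order_same: "i \<in> I \<Longrightarrow> cox_order W s i i = 1"
  unfolding cox_order_def by (simp add: gen_involution)

lemma cox_order_ge_2:
  assumes "i \<in> I" "j \<in> I" "i \<noteq> j" "cox_order W s i j \<noteq> 0"
  shows "cox_order W s i j \<ge> 2"
proof (rule ccontr)
  assume "\<not> ?thesis"
  then have "cox_order W s i j = 1" using assms by linarith
  then have "s i \<otimes> s j = \<one>"
    using assms gen_closed unfolding cox_order_def by (metis m_closed ord_eq_1)
  then have "s i = inv (s j)"
    using assms gen_closed inv_equality by (metis)
  then show False
    using assms gen_inj by (auto simp: gen_inv inj_on_def)
qed

lemma gram_sym: "i \<in> I \<Longrightarrow> j \<in> I \<Longrightarrow> gram i j = gram j i"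
  by (simp add: gram_def cox_order_sym)

lemma gram_same: "i \<in> I \<Longrightarrow> gram i i = 1"
  by (simp add: gram_def cox_order_same)

lemma bform_sym: "bform u v = bform v u"
  unfolding bform_def
  by (subst sum.swap) (auto intro!: sum.cong simp: gram_sym)

lemma bform_lin:
  "bform (\<lambda>j. a * u j + b * v j) w = a * bform u w + b * bform v w"
  unfolding bform_def by (simp add: algebra_simps sum.distrib sum_distrib_left)

lemma bform_simple:
  assumes "i \<in> I"
  shows "bform v (simple_root i) = (\<Sum>k\<in>I. v k * gram k i)"
proof -
  have "(\<Sum>j\<in>I. v k * simple_root i j * gram k j) = v k * gram k i" if "k \<in> I" for k
  proof -
    have "(\<Sum>j\<in>I. v k * simple_root i j * gram k j) = (\<Sum>j\<in>I. if j = i then v k * gram k i else 0)"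
      by (intro sum.cong) (auto simp: simple_root_def)
    then show ?thesis using assms finite_index by simp
  qed
  then show ?thesis unfolding bform_def by simp
qed

lemma bform_simple_simple:
  assumes "i \<in> I" "j \<in> I"
  shows "bform (simple_root i) (simple_root j) = gram i j"
proof -
  have "bform (simple_root i) (simple_root j) = (\<Sum>k\<in>I. if k = i then gram i j else 0)"
    unfolding bform_simple[OF assms(2)] by (intro sum.cong) (auto simp: simple_root_def)
  then show ?thesis using assms finite_index by simp
qed

lemma reflect_lin:
  "reflect i (\<lambda>j. a * u j + b * v j) = (\<lambda>j. a * reflect i u j + b * reflect i v j)"
  unfolding reflect_def bform_lin by (simp add: algebra_simps)

lemma reflect_simple:
  assumes "i \<in> I" "j \<in> I"
  shows "reflect i (simple_root j) = (\<lambda>k. simple_root j k - 2 * gram i j * simple_root i k)"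
  using assms by (simp add: reflect_def bform_simple_simple gram_sym)

lemma reflect_same: "i \<in> I \<Longrightarrow> reflect i (simple_root i) = (\<lambda>k. - simple_root i k)"
  by (simp add: reflect_simple gram_same)

lemma bform_reflect_left:
  "bform (reflect i u) v = bform u v - 2 * bform u (simple_root i) * bform (simple_root i) v"
  using bform_lin[of 1 u "- 2 * bform u (simple_root i)" "simple_root i" v]
  by (simp add: reflect_def)

lemma bform_reflect:
  assumes "i \<in> I"
  shows "bform (reflect i u) (reflect i v) = bform u v"
proof -
  have "bform (simple_root i) (reflect i v) = - bform v (simple_root i)"
    unfolding bform_sym[of "simple_root i" "reflect i v"] bform_reflect_left
    using assms by (simp add: bform_simple_simple gram_same)
  moreover have "bform u (reflect i v) = bform u v - 2 * bform v (simple_root i) * bform u (simple_root i)"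
    unfolding bform_sym[of u "reflect i v"] bform_reflect_left
    by (simp add: bform_sym)
  ultimately show ?thesis
    unfolding bform_reflect_left by (simp add: algebra_simps)
qed

lemma reflect_reflect:
  assumes "i \<in> I"
  shows "reflect i (reflect i v) = v"
proof -
  have "bform (reflect i v) (simple_root i) = - bform v (simple_root i)"
    unfolding bform_reflect_left using assms by (simp add: bform_simple_simple gram_same)
  then show ?thesis
    unfolding reflect_def[of i "reflect i v"] by (simp add: reflect_def)
qed

lemma foldr_reflect_lin:
  "foldr reflect xs (\<lambda>j. a * u j + b * v j)
     = (\<lambda>j. a * foldr reflect xs u j + b * foldr reflect xs v j)"
  by (induction xs) (auto simp: reflect_lin)

text \<open>Each new letter is the one whose simple root carries the older coefficient
  \<open>cheb _ k\<close>. Only that coefficient changes, by exactly one step of the three-term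
  recursion.\<close>

lemma foldr_reflect_altw:
  assumes "a \<in> I" "b \<in> I"
  shows "foldr reflect (altw a b k) (simple_root a)
    = (\<lambda>j. cheb (- gram a b) (Suc k) * simple_root (if even k then a else b) j
         + cheb (- gram a b) k * simple_root (if even k then b else a) j)"
proof (induction k)
  case (Suc k)
  show ?case
    by (simp add: Suc reflect_lin reflect_simple assms gram_same gram_sym[OF assms(2,1)])
      (auto simp: algebra_simps)
qed auto

text \<open>On the plane spanned by the two simple roots the relation is the periodicity of the
  Chebyshev recursion. This plane has an orthogonal complement because the form is nondegenerate
  on it when the order is finite.\<close>

lemma reflect_dihedral:
  assumes ij: "i \<in> I" "j \<in> I"
  shows "foldr reflect (concat (replicate (cox_order W s i j) [i, j])) v = v"
proof (cases "i = j \<or> cox_order W s i j = 0")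
  case True
  then show ?thesis
    using assms by (auto simp: cox_order_same reflect_reflect)
next
  case False
  define m where "m = cox_order W s i j"
  have m: "m \<ge> 2" using cox_order_ge_2 assms False m_def by auto
  define t where "t = pi / real m"
  have t: "0 < t" "t < pi" using m pi_gt_zero by (auto simp: t_def field_simps)
  have g: "gram i j = - cos t" "gram j i = - cos t"
    using False by (auto simp: gram_def t_def m_def cox_order_sym[OF ij])
  have sint: "sin t > 0" using t sin_gt_zero by blast
  have mt: "real m * t = pi" using m by (simp add: t_def)
  \<comment> \<open>The word of \<open>m\<close> copies of \<open>[i, j]\<close> is alternating of
    length \<open>2 * m\<close>. This amounts to a full turn 2 pi, so the Chebyshev values return to
    their initial pair 0, 1.\<close>
  have "sin (real (2 * m) * t) = 0" "sin (real (Suc (2 * m)) * t) = sin t"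
  proof -
    have e: "real (2 * m) * t = 2 * pi" "real (Suc (2 * m)) * t = t + 2 * pi"
      using mt by (auto simp: algebra_simps)
    show "sin (real (2 * m) * t) = 0" "sin (real (Suc (2 * m)) * t) = sin t"
      unfolding e by simp_all
  qed
  then have ch: "cheb (cos t) (2 * m) = 0" "cheb (cos t) (Suc (2 * m)) = 1"
    using sint sin_mult_cheb_cos[of t "2 * m"] sin_mult_cheb_cos[of t "Suc (2 * m)"]
    by (simp_all del: cheb.simps)
  have fix1: "foldr reflect (concat (replicate m [a, b])) (simple_root a) = simple_root a"
    if "a \<in> I" "b \<in> I" "gram a b = - cos t" for a b
    using foldr_reflect_altw[OF that(1,2), of "2 * m"] ch that(3)
    unfolding altw_even by (simp del: cheb.simps)
  \<comment> \<open>\<open>fix1\<close> treats only the simple root of the first letter of the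
    repeated pair. For the other one it applies to the reversed pairs, whose product is inverse to
    the given one.\<close>
  have inv: "foldr reflect (concat (replicate n [i, j])) (foldr reflect (concat (replicate n [j, i])) u) = u"
    for n u
  proof (induction n arbitrary: u)
    case (Suc n)
    have "concat (replicate (Suc n) [i, j]) = concat (replicate n [i, j]) @ [i, j]"
      by (simp only: replicate_Suc replicate_append_same[symmetric] concat_append) simp
    then show ?case using Suc by (simp add: reflect_reflect ij)
  qed auto
  have fi: "foldr reflect (concat (replicate m [i, j])) (simple_root i) = simple_root i"
    using fix1 g ij by simp
  have fj: "foldr reflect (concat (replicate m [i, j])) (simple_root j) = simple_root j"
    using inv[of m "simple_root j"] fix1[OF ij(2,1) g(2)] by simp
  define x y where "x = bform v (simple_root i)" and "y = bform v (simple_root j)"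
  \<comment> \<open>\<open>d\<close> is the determinant of the Gram matrix of the two simple roots,
    and \<open>p\<close>, \<open>q\<close> solve the resulting linear system. Thus \<open>h\<close>
    is the orthogonal projection of \<open>v\<close> to the plane and \<open>u\<close> is orthogonal
    to it.\<close>
  define d where "d = (sin t)\<^sup>2"
  have d: "d \<noteq> 0" using sint by (simp add: d_def)
  have d': "d = 1 - (cos t)\<^sup>2" by (simp add: d_def sin_squared_eq)
  define p q where "p = (x + cos t * y) / d" and "q = (y + cos t * x) / d"
  define h where "h = (\<lambda>k. p * simple_root i k + q * simple_root j k)"
  define u where "u = (\<lambda>k. 1 * v k + (- 1) * h k)"
  have "bform h (simple_root i) = p - q * cos t" "bform h (simple_root j) = q - p * cos t"
    unfolding h_def bform_lin by (auto simp: bform_simple_simple ij gram_same g)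
  moreover have "p - q * cos t = x" "q - p * cos t = y"
  proof -
    have "p - q * cos t = x * (1 - (cos t)\<^sup>2) / d" "q - p * cos t = y * (1 - (cos t)\<^sup>2) / d"
      by (simp_all add: p_def q_def field_simps power2_eq_square d)
    then show "p - q * cos t = x" "q - p * cos t = y"
      using d d' by auto
  qed
  ultimately have "bform u (simple_root i) = 0" "bform u (simple_root j) = 0"
    unfolding u_def bform_lin by (auto simp: x_def y_def)
  then have "reflect i u = u" "reflect j u = u"
    by (auto simp: reflect_def)
  then have fu: "foldr reflect (concat (replicate n [i, j])) u = u" for n
    by (induction n) auto
  have fh: "foldr reflect (concat (replicate m [i, j])) h = h"
    unfolding h_def foldr_reflect_lin fi fj by simp
  have v: "v = (\<lambda>k. 1 * u k + 1 * h k)" by (auto simp: u_def)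
  show ?thesis
    unfolding m_def[symmetric] by (subst (1 2) v) (simp only: foldr_reflect_lin fu fh)
qed

text \<open>Together with \<open>presentation\<close> this makes \<open>act\<close> independent of
  the word chosen for an element.\<close>

lemma equivclp_relator_foldr_reflect:
  "equivclp (relator_step W I s) xs ys \<Longrightarrow> foldr reflect xs = foldr reflect ys"
proof (induction rule: equivclp_induct)
  case (step y z)
  have "foldr reflect a = foldr reflect b" if "relator_step W I s a b" for a b
    using that by induction (auto simp: fun_eq_iff reflect_dihedral)
  then show ?case using step by metis
qed auto

text \<open>All relators have even length, so the parity of a word depends only on the group element
  it represents.\<close>

lemma equivclp_relator_parity:
  "equivclp (relator_step W I s) xs ys \<Longrightarrow> even (length xs) = even (length ys)"
proof (induction rule: equivclp_induct)
  case (step y z)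
  have *: "even (length (concat (replicate n [i, j])))" for n and i j :: 'i
    by (induction n) auto
  have "even (length a) = even (length b)" if "relator_step W I s a b" for a b
    using that by induction (simp add: * del: length_concat)
  then show ?case using step by metis
qed auto

section \<open>The action\<close>

lemma act_wp:
  assumes "xs \<in> lists I"
  shows "act (wp xs) = foldr reflect xs"
proof -
  define ys where "ys = (SOME ys. ys \<in> lists I \<and> wp ys = wp xs)"
  have "ys \<in> lists I \<and> wp ys = wp xs"
    unfolding ys_def by (rule someI[of _ xs]) (use assms in auto)
  then have "foldr reflect ys = foldr reflect xs"
    using assms presentation equivclp_relator_foldr_reflect by blast
  then show ?thesis unfolding act_def ys_def .
qed

lemma act_mult:
  assumes "v \<in> carrier W" "w \<in> carrier W"
  shows "act (v \<otimes> w) \<beta> = act v (act w \<beta>)"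
proof -
  obtain xs ys where "xs \<in> lists I" "wp xs = v" "ys \<in> lists I" "wp ys = w"
    using word_exists assms by metis
  then show ?thesis
    using act_wp[of "xs @ ys"] act_wp[of xs] act_wp[of ys] by (auto simp: wp_append)
qed

lemma act_one [simp]: "act \<one> \<beta> = \<beta>"
  using act_wp[of "[]"] by simp

lemma act_gen: "i \<in> I \<Longrightarrow> act (s i) \<beta> = reflect i \<beta>"
  using act_wp[of "[i]"] by (simp add: gen_closed)

lemma act_inv [simp]: "w \<in> carrier W \<Longrightarrow> act w (act (inv w) \<beta>) = \<beta>"
  "w \<in> carrier W \<Longrightarrow> act (inv w) (act w \<beta>) = \<beta>"
  by (simp_all flip: act_mult)

lemma act_lin:
  assumes "w \<in> carrier W"
  shows "act w (\<lambda>j. a * u j + b * v j) = (\<lambda>j. a * act w u j + b * act w v j)"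
  using word_exists[OF assms] act_wp foldr_reflect_lin by metis

lemma act_uminus: "w \<in> carrier W \<Longrightarrow> act w (\<lambda>j. - u j) = (\<lambda>j. - act w u j)"
  using act_lin[of w "- 1" u 0 u] by simp

lemma act_gen_simple:
  "w \<in> carrier W \<Longrightarrow> i \<in> I \<Longrightarrow> act (w \<otimes> s i) (simple_root i) = (\<lambda>j. - act w (simple_root i) j)"
  by (simp add: act_mult act_gen gen_closed reflect_same act_uminus)

lemma bform_act:
  assumes "w \<in> carrier W"
  shows "bform (act w u) (act w v) = bform u v"
proof -
  obtain xs where xs: "xs \<in> lists I" "wp xs = w" using word_exists assms by blast
  have "bform (foldr reflect xs u) (foldr reflect xs v) = bform u v"
    using xs(1) by (induction xs) (auto simp: bform_reflect)
  then show ?thesis using act_wp xs by metis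
qed

section \<open>Length\<close>

definition len :: "'g \<Rightarrow> nat" where
  "len w = (LEAST n. \<exists>xs \<in> lists I. length xs = n \<and> wp xs = w)"

lemma len_wp_le: "xs \<in> lists I \<Longrightarrow> len (wp xs) \<le> length xs"
  unfolding len_def by (rule Least_le) blast

lemma reduced_word_exists:
  assumes "w \<in> carrier W"
  shows "\<exists>xs \<in> lists I. length xs = len w \<and> wp xs = w"
  unfolding len_def by (rule LeastI_ex) (use word_exists[OF assms] in blast)

lemma len_mult_wp_le:
  assumes "w \<in> carrier W" "xs \<in> lists I"
  shows "len (w \<otimes> wp xs) \<le> len w + length xs"
proof -
  obtain ys where ys: "ys \<in> lists I" "length ys = len w" "wp ys = w"
    using reduced_word_exists assms by blast
  then have "len (wp (ys @ xs)) \<le> length (ys @ xs)"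
    using assms by (intro len_wp_le) auto
  then show ?thesis using ys assms by (simp add: wp_append)
qed

lemma mult_gen_gen: "w \<in> carrier W \<Longrightarrow> i \<in> I \<Longrightarrow> w \<otimes> s i \<otimes> s i = w"
  by (simp add: m_assoc gen_closed gen_involution)

text \<open>Appending one letter changes the length by at most one in either direction, and parity
  excludes equality.\<close>

lemma len_mult_gen:
  assumes "w \<in> carrier W" "i \<in> I"
  shows "len (w \<otimes> s i) = Suc (len w) \<or> len w = Suc (len (w \<otimes> s i))"
proof -
  have c: "w \<otimes> s i \<in> carrier W" using assms gen_closed by blast
  have 1: "len (w \<otimes> s i) \<le> len w + 1"
    using len_mult_wp_le[of w "[i]"] assms gen_closed by simp
  have 2: "len w \<le> len (w \<otimes> s i) + 1"
    using len_mult_wp_le[of "w \<otimes> s i" "[i]"] assms gen_closed c by (simp add: mult_gen_gen)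
  obtain xs where xs: "xs \<in> lists I" "length xs = len w" "wp xs = w"
    using reduced_word_exists assms by blast
  obtain ys where ys: "ys \<in> lists I" "length ys = len (w \<otimes> s i)" "wp ys = w \<otimes> s i"
    using reduced_word_exists c by blast
  have "wp (xs @ [i]) = wp ys" using xs ys assms gen_closed by (simp add: wp_append)
  then have "even (length (xs @ [i])) = even (length ys)"
    using xs ys assms equivclp_relator_parity presentation by (metis append_in_lists_conv lists.simps)
  then have "len (w \<otimes> s i) \<noteq> len w" using xs ys by auto
  then show ?thesis using 1 2 by linarith
qed

lemma len_descent_exists:
  assumes "w \<in> carrier W" "w \<noteq> \<one>"
  obtains i where "i \<in> I" "len w = Suc (len (w \<otimes> s i))"
proof -
  obtain xs where xs: "xs \<in> lists I" "length xs = len w" "wp xs = w"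
    using reduced_word_exists assms by blast
  then obtain ys i where yi: "xs = ys @ [i]" using assms by (cases xs rule: rev_cases) auto
  have *: "ys \<in> lists I" "i \<in> I" using xs yi by auto
  then have "w = wp ys \<otimes> s i" using xs yi gen_closed by (simp add: wp_append)
  then have "w \<otimes> s i = wp ys" using * by (simp add: mult_gen_gen)
  then have "len (w \<otimes> s i) < len w" using len_wp_le[OF *(1)] xs yi by auto
  then show ?thesis using that * len_mult_gen[OF assms(1) *(2)] by auto
qed

section \<open>Positive and negative roots\<close>

lemma conj_pow:
  assumes "x \<in> carrier W" "y \<in> carrier W"
  shows "x \<otimes> (y \<otimes> x) [^] (k::nat) \<otimes> y = (x \<otimes> y) [^] Suc k"
proof (induction k)
  case (Suc k)
  have "x \<otimes> (y \<otimes> x) [^] Suc k \<otimes> y = (x \<otimes> (y \<otimes> x) [^] k \<otimes> y) \<otimes> (x \<otimes> y)"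
    using assms by (simp add: m_assoc)
  then show ?case using Suc by simp
qed (use assms in simp)

lemma wp_altw_quotient:
  assumes "a \<in> I" "b \<in> I"
  shows "wp (altw a b k) \<otimes> inv (wp (altw b a k))
    = (if even k then s a \<otimes> s b else s b \<otimes> s a) [^] k"
proof (induction k)
  case (Suc k)
  have c: "wp (altw a b k) \<in> carrier W" "wp (altw b a k) \<in> carrier W" "s a \<in> carrier W" "s b \<in> carrier W"
    using assms by (auto simp: altw_in_lists gen_closed)
  have *: "(x \<otimes> wp (altw a b k)) \<otimes> inv (y \<otimes> wp (altw b a k)) = (x \<otimes> y) [^] Suc k"
    if "x \<in> carrier W" "y \<in> carrier W" "inv y = y"
      "wp (altw a b k) \<otimes> inv (wp (altw b a k)) = (y \<otimes> x) [^] k" for x y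
  proof -
    have "(x \<otimes> wp (altw a b k)) \<otimes> inv (y \<otimes> wp (altw b a k))
        = x \<otimes> (wp (altw a b k) \<otimes> inv (wp (altw b a k))) \<otimes> y"
      using c that(1-3) by (simp add: inv_mult_group m_assoc)
    then show ?thesis using that conj_pow by simp
  qed
  show ?case
    using Suc *[of "s a" "s b"] *[of "s b" "s a"] c assms by (auto simp: gen_inv simp del: nat_pow_Suc)
qed auto

text \<open>The quotient of the two alternating words is the power of a product of the two
  generators whose exponent is its order, hence trivial.\<close>

lemma wp_altw_braid:
  assumes "a \<in> I" "b \<in> I"
  shows "wp (altw a b (cox_order W s a b)) = wp (altw b a (cox_order W s a b))"
proof -
  let ?m = "cox_order W s a b"
  have "(s a \<otimes> s b) [^] ?m = \<one>" "(s b \<otimes> s a) [^] ?m = \<one>"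
    using pow_ord_eq_1 gen_closed assms cox_order_sym[OF assms] unfolding cox_order_def
    by (metis m_closed)+
  then have "wp (altw a b ?m) \<otimes> inv (wp (altw b a ?m)) = \<one>"
    using wp_altw_quotient[OF assms, of ?m] by auto
  then show ?thesis
    using assms by (metis altw_in_lists inv_closed inv_equality inv_inv wp_closed)
qed

text \<open>For finite order m the value is sin(k pi/m) / sin(pi/m), with the angle in [0, pi]. For
  infinite order (encoded by 0) the argument is 1 and the value is \<open>k\<close>.\<close>

lemma cheb_gram_nonneg:
  assumes "a \<in> I" "b \<in> I" "a \<noteq> b" "cox_order W s a b = 0 \<or> k \<le> cox_order W s a b"
  shows "0 \<le> cheb (- gram a b) k"
proof (cases "cox_order W s a b = 0")
  case True
  then show ?thesis by (simp add: gram_def cheb_one)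
next
  case False
  let ?t = "pi / real (cox_order W s a b)"
  have m: "cox_order W s a b \<ge> 2" using cox_order_ge_2 assms False by blast
  then have "sin ?t > 0" by (intro sin_gt_zero) (auto simp: field_simps)
  moreover have "0 \<le> sin (real k * ?t)"
    using assms(4) m by (intro sin_ge_zero) (auto simp: field_simps)
  ultimately show ?thesis
    using False sin_mult_cheb_cos[of ?t k] by (simp add: gram_def) (metis zero_le_mult_iff not_le)
qed

text \<open>Split off from the right end of \<^term>\<open>w\<close> the longest alternating word in \<^term>\<open>i\<close> and a descent
  of \<^term>\<open>w\<close>. The remaining left factor is shorter and has neither of the two letters as a
  descent, and the alternating word is too short to allow a braid move.\<close>

lemma act_simple_nonneg:
  assumes "w \<in> carrier W" "i \<in> I" "len w < len (w \<otimes> s i)" "j \<in> I"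
  shows "0 \<le> act w (simple_root i) j"
  using assms
proof (induction "len w" arbitrary: w i rule: less_induct)
  case less
  note wi = less.prems(1,2)
  show ?case
  proof (cases "w = \<one>")
    case True
    then show ?thesis by (simp add: simple_root_def)
  next
    case False
    then obtain t where t: "t \<in> I" "len w = Suc (len (w \<otimes> s t))"
      using len_descent_exists wi by blast
    then have it: "i \<noteq> t" using less.prems by auto
    let ?p = "altw i t"
    have pl: "?p k \<in> lists I" for k by (simp add: altw_in_lists wi t(1))
    define Q where "Q k \<longleftrightarrow> (\<exists>v\<in>carrier W. w = v \<otimes> wp (?p k) \<and> len v + k = len w)" for k
    have Q1: "Q 1"
      unfolding Q_def
      by (intro bexI[of _ "w \<otimes> s t"]) (use t(2) in \<open>simp_all add: wi t(1) gen_closed mult_gen_gen\<close>)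
    have bound: "Q k \<Longrightarrow> k \<le> len w" for k unfolding Q_def by auto
    define k where "k = (GREATEST k. Q k)"
    have Qk: "Q k" unfolding k_def using GreatestI_nat[of Q 1 "len w"] Q1 bound by blast
    have kmax: "Q n \<Longrightarrow> n \<le> k" for n unfolding k_def using Greatest_le_nat[of Q n "len w"] bound by blast
    have k1: "k \<ge> 1" using kmax Q1 by blast
    obtain v where v: "v \<in> carrier W" "w = v \<otimes> wp (?p k)" "len v + k = len w"
      using Qk unfolding Q_def by blast
    \<comment> \<open>\<open>r\<close> is the letter that would extend the alternating word on the
      left, \<open>r'\<close> is its present first letter. The first cannot be a descent of
      \<open>v\<close> by maximality of \<open>k\<close>, the second because cancelling it would
      shorten \<open>w\<close>.\<close>
    define r r' where "r = (if even k then t else i)" and "r' = (if even k then i else t)"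
    have rI: "r \<in> I" "r' \<in> I" using wi t by (auto simp: r_def r'_def)
    have "len v < len (v \<otimes> s r)"
    proof (rule ccontr)
      assume "\<not> ?thesis"
      then have "len v = Suc (len (v \<otimes> s r))" using len_mult_gen[OF v(1) rI(1)] by auto
      moreover have "v \<otimes> s r \<otimes> wp (?p (Suc k)) = w"
      proof -
        have "wp (?p (Suc k)) = s r \<otimes> wp (?p k)" by (simp add: r_def)
        then have "v \<otimes> s r \<otimes> wp (?p (Suc k)) = v \<otimes> s r \<otimes> s r \<otimes> wp (?p k)"
          using v rI pl gen_closed by (simp add: m_assoc del: altw.simps)
        then show ?thesis using v rI by (simp add: mult_gen_gen)
      qed
      ultimately have "Q (Suc k)"
        unfolding Q_def using v rI gen_closed by (intro bexI[of _ "v \<otimes> s r"]) auto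
      then show False using kmax by force
    qed
    moreover have "len v < len (v \<otimes> s r')"
    proof -
      obtain k' where k': "k = Suc k'" using k1 by (cases k) auto
      have "wp (?p k) = s r' \<otimes> wp (?p k')" by (simp add: k' r'_def)
      then have "w = v \<otimes> s r' \<otimes> wp (?p k')"
        using v rI pl gen_closed by (simp add: m_assoc)
      then have "len w \<le> len (v \<otimes> s r') + k'"
        using len_mult_wp_le[of "v \<otimes> s r'" "?p k'"] v rI pl gen_closed by simp
      then show ?thesis using v k' by linarith
    qed
    ultimately have vr: "len v < len (v \<otimes> s i)" "len v < len (v \<otimes> s t)"
      by (auto simp: r_def r'_def split: if_splits)
    have lv: "len v < len w" using v k1 by linarith
    have nonneg: "0 \<le> act v (simple_root i) j" "0 \<le> act v (simple_root t) j"
      using less.hyps[OF lv v(1)] vr wi t less.prems(4) by auto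
    \<comment> \<open>Otherwise a braid move makes the alternating word end in \<open>i\<close>.
      Then \<open>w \<otimes> s i\<close> cancels that letter and is shorter than \<open>w\<close>,
      against the assumption.\<close>
    have short: "cox_order W s i t = 0 \<or> k < cox_order W s i t"
    proof (rule ccontr)
      let ?m = "cox_order W s i t"
      assume "\<not> ?thesis"
      then have m: "?m \<noteq> 0" "k = (k - ?m) + ?m" by auto
      obtain xs where xs: "?p k = xs @ ?p ?m" "length xs = k - ?m" "set xs \<subseteq> {i, t}"
        using altw_add[of i t "k - ?m" ?m] m(2) by metis
      obtain m' where m': "?m = Suc m'" using m by (cases ?m) auto
      have xl: "xs \<in> lists I" using xs wi t by auto
      have "wp (?p k) = wp xs \<otimes> wp (altw t i ?m)"
        using xs xl pl wp_altw_braid[OF wi(2) t(1)] by (simp add: wp_append)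
      also have "wp (altw t i ?m) = wp (altw i t m') \<otimes> s i"
        unfolding m' altw_Suc_right using pl wi gen_closed by (simp add: wp_append)
      finally have "w \<otimes> s i = v \<otimes> wp (xs @ altw i t m')"
        using v xl pl wi gen_closed gen_involution by (simp add: wp_append m_assoc)
      then have "len (w \<otimes> s i) \<le> len v + length (xs @ altw i t m')"
        using len_mult_wp_le[OF v(1), of "xs @ altw i t m'"] xl pl by simp
      then show False using xs v m' m less.prems(3) by simp
    qed
    have "act w (simple_root i) j = act v (foldr reflect (?p k) (simple_root i)) j"
      using v act_mult act_wp pl by simp
    also have "\<dots> = cheb (- gram i t) (Suc k) * act v (simple_root (if even k then i else t)) j
         + cheb (- gram i t) k * act v (simple_root (if even k then t else i)) j"
      unfolding foldr_reflect_altw[OF wi(2) t(1)] act_lin[OF v(1)] ..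
    \<comment> \<open>The strict bound on \<open>k\<close> keeps even the index \<open>Suc k\<close>
      in the range where the Chebyshev values are nonnegative.\<close>
    also have "\<dots> \<ge> 0"
      using cheb_gram_nonneg[OF wi(2) t(1) it, of k] cheb_gram_nonneg[OF wi(2) t(1) it, of "Suc k"]
        short nonneg by (auto intro!: add_nonneg_nonneg mult_nonneg_nonneg simp del: cheb.simps)
    finally show ?thesis .
  qed
qed

section \<open>Closure properties, norm and sign of roots\<close>

lemma simple_root_in_roots: "i \<in> I \<Longrightarrow> simple_root i \<in> roots"
  unfolding roots_def by (metis (mono_tags, lifting) act_one mem_Collect_eq one_closed)

lemma act_in_roots: "w \<in> carrier W \<Longrightarrow> \<beta> \<in> roots \<Longrightarrow> act w \<beta> \<in> roots"
  unfolding roots_def by (smt (verit) act_mult m_closed mem_Collect_eq)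

lemma reflect_in_roots: "i \<in> I \<Longrightarrow> \<beta> \<in> roots \<Longrightarrow> reflect i \<beta> \<in> roots"
  using act_in_roots act_gen gen_closed by metis

lemma uminus_in_roots:
  assumes "\<beta> \<in> roots" shows "(\<lambda>j. - \<beta> j) \<in> roots"
proof -
  obtain w i where w: "w \<in> carrier W" "i \<in> I" "\<beta> = act w (simple_root i)"
    using assms unfolding roots_def by blast
  then have "(\<lambda>j. - \<beta> j) = act (w \<otimes> s i) (simple_root i)" "w \<otimes> s i \<in> carrier W"
    by (simp_all add: act_gen_simple gen_closed)
  then show ?thesis
    unfolding roots_def using w(2) by blast
qed

lemma bform_root:
  assumes "\<beta> \<in> roots" shows "bform \<beta> \<beta> = 1"
proof -
  obtain w i where "w \<in> carrier W" "i \<in> I" "\<beta> = act w (simple_root i)"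
    using assms unfolding roots_def by blast
  then show ?thesis by (simp add: bform_act bform_simple_simple gram_same)
qed

lemma root_outside:
  assumes "\<beta> \<in> roots" "j \<notin> I" shows "\<beta> j = 0"
proof -
  obtain w i where w: "w \<in> carrier W" "i \<in> I" "\<beta> = act w (simple_root i)"
    using assms unfolding roots_def by blast
  obtain xs where xs: "xs \<in> lists I" "wp xs = w" using word_exists w by blast
  have "foldr reflect xs (simple_root i) j = 0"
    using xs(1) by (induction xs) (use w assms(2) in \<open>auto simp: reflect_def simple_root_def\<close>)
  then show ?thesis using w xs act_wp by metis
qed

text \<open>If \<open>s i\<close> is a descent of \<open>w\<close>, then it is an ascent of
  \<open>w \<otimes> s i\<close>, which sends the simple root to the negative of the given
  root.\<close>

lemma pos_or_neg:
  assumes "\<beta> \<in> roots" shows "\<beta> \<in> pos_roots \<or> (\<lambda>j. - \<beta> j) \<in> pos_roots"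
proof -
  obtain w i where w: "w \<in> carrier W" "i \<in> I" "\<beta> = act w (simple_root i)"
    using assms unfolding roots_def by blast
  show ?thesis
  proof (cases "len w < len (w \<otimes> s i)")
    case True
    then show ?thesis using act_simple_nonneg w assms unfolding pos_roots_def by blast
  next
    case False
    then have "len (w \<otimes> s i) < len (w \<otimes> s i \<otimes> s i)"
      using len_mult_gen w by (force simp: mult_gen_gen)
    then have "\<forall>j\<in>I. 0 \<le> act (w \<otimes> s i) (simple_root i) j"
      using act_simple_nonneg w gen_closed by blast
    then show ?thesis
      using act_gen_simple w uminus_in_roots[OF assms] unfolding pos_roots_def by auto
  qed
qed

lemma not_pos_and_neg:
  assumes "\<beta> \<in> pos_roots" shows "(\<lambda>j. - \<beta> j) \<notin> pos_roots"
proof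
  assume "(\<lambda>j. - \<beta> j) \<in> pos_roots"
  then have "\<forall>j\<in>I. \<beta> j = 0" using assms unfolding pos_roots_def by force
  then have "bform \<beta> \<beta> = 0" by (simp add: bform_def)
  then show False using bform_root assms unfolding pos_roots_def by auto
qed

lemma neg_iff: "\<beta> \<in> roots \<Longrightarrow> (\<lambda>j. - \<beta> j) \<in> pos_roots \<longleftrightarrow> \<beta> \<notin> pos_roots"
  using pos_or_neg not_pos_and_neg by blast

text \<open>The reflection alters only coordinate \<open>i\<close>, so a sign change forces all
  other coordinates to vanish. Among nonnegative multiples of a simple root, only the simple root
  itself has norm 1.\<close>

lemma reflect_pos:
  assumes "\<beta> \<in> pos_roots" "i \<in> I" "reflect i \<beta> \<notin> pos_roots"
  shows "\<beta> = simple_root i"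
proof -
  have r: "\<beta> \<in> roots" using assms unfolding pos_roots_def by simp
  then have "(\<lambda>j. - reflect i \<beta> j) \<in> pos_roots"
    using assms neg_iff reflect_in_roots by blast
  then have "\<beta> j = 0" if "j \<in> I" "j \<noteq> i" for j
    using assms that unfolding pos_roots_def by (force simp: reflect_def simple_root_def)
  then have "\<beta> j = 0" if "j \<noteq> i" for j using root_outside r that by blast
  \<comment> \<open>The summand with coefficient 0 gives the two-term shape required by
    \<open>bform_lin\<close>.\<close>
  then have b: "\<beta> = (\<lambda>j. \<beta> i * simple_root i j + 0 * simple_root i j)"
    by (auto simp: simple_root_def)
  have *: "bform \<beta> v = \<beta> i * bform (simple_root i) v" for v
    using arg_cong[OF b, of "\<lambda>u. bform u v"] unfolding bform_lin by simp
  have "bform \<beta> \<beta> = \<beta> i * bform \<beta> (simple_root i)"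
    using *[of \<beta>] by (simp add: bform_sym[of "simple_root i"])
  also have "bform \<beta> (simple_root i) = \<beta> i"
    using *[of "simple_root i"] assms by (simp add: bform_simple_simple gram_same)
  finally have "\<beta> i * \<beta> i = 1" using bform_root r by simp
  moreover have "\<beta> i \<ge> 0" using assms unfolding pos_roots_def by blast
  ultimately have "\<beta> i = 1" using square_eq_1_iff by fastforce
  then show ?thesis using b by simp
qed

section \<open>Separating roots\<close>

lemma half_space_iff: "w \<in> half_space \<beta> \<longleftrightarrow> w \<in> carrier W \<and> act w \<beta> \<in> pos_roots"
  by (auto simp: half_space_def)

lemma simple_root_pos: "i \<in> I \<Longrightarrow> simple_root i \<in> pos_roots"
  unfolding pos_roots_def using simple_root_in_roots by (auto simp: simple_root_def)

lemma half_space_uminus: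
  assumes "w \<in> carrier W" "\<beta> \<in> roots"
  shows "w \<in> half_space (\<lambda>j. - \<beta> j) \<longleftrightarrow> w \<notin> half_space \<beta>"
  using assms act_in_roots neg_iff by (simp add: half_space_iff act_uminus)

text \<open>Left multiplication by \<open>s i\<close> can leave only one half-space, and its root is
  exactly the one tested by the toggle.\<close>

lemma half_space_cross:
  assumes "w \<in> carrier W" "i \<in> I" "w \<in> half_space \<beta>" "s i \<otimes> w \<notin> half_space \<beta>"
  shows "\<beta> = act (inv w) (simple_root i)"
proof -
  have "act w \<beta> = simple_root i"
    using assms reflect_pos by (auto simp: half_space_iff act_mult act_gen gen_closed)
  then show ?thesis using act_inv(2)[OF assms(1)] by metis
qed

definition separating :: "'g \<Rightarrow> 'g \<Rightarrow> ('i \<Rightarrow> real) set" where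
  "separating v w = {\<beta> \<in> roots. (v \<in> half_space \<beta>) \<noteq> (w \<in> half_space \<beta>)}"

text \<open>Along a word each letter crosses a single wall, so it contributes at most one root and
  its negative.\<close>

lemma finite_separating:
  assumes "v \<in> carrier W" "w \<in> carrier W"
  shows "finite (separating v w)"
proof -
  have *: "finite (separating \<one> (wp xs))" if "xs \<in> lists I" for xs
    using that
  proof (induction xs)
    case Nil
    then show ?case by (simp add: separating_def)
  next
    case (Cons i xs)
    let ?u = "wp xs"
    let ?\<gamma> = "act (inv ?u) (simple_root i)"
    have u: "?u \<in> carrier W" "i \<in> I" using Cons by auto
    have "separating \<one> (s i \<otimes> ?u) \<subseteq> separating \<one> ?u \<union> {?\<gamma>, \<lambda>j. - ?\<gamma> j}"
    proof
      fix \<beta> assume b: "\<beta> \<in> separating \<one> (s i \<otimes> ?u)"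
      then have r: "\<beta> \<in> roots" by (simp add: separating_def)
      have su: "s i \<otimes> ?u \<in> carrier W" using u gen_closed by blast
      show "\<beta> \<in> separating \<one> ?u \<union> {?\<gamma>, \<lambda>j. - ?\<gamma> j}"
      proof (cases "?u \<in> half_space \<beta> \<longleftrightarrow> s i \<otimes> ?u \<in> half_space \<beta>")
        case True
        then show ?thesis using b by (simp add: separating_def)
      next
        case False
        show ?thesis
        proof (cases "?u \<in> half_space \<beta>")
          case True
          then show ?thesis using half_space_cross u False by blast
        next
          \<comment> \<open>Entering the half-space of \<open>\<beta>\<close> means leaving that of
            its negative, to which \<open>half_space_cross\<close> applies.\<close>
          case nu: False
          then have "(\<lambda>j. - \<beta> j) = ?\<gamma>"
            using half_space_cross[OF u] False half_space_uminus u(1) su r by blast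
          then have "\<beta> = (\<lambda>j. - ?\<gamma> j)" by (metis (no_types) minus_minus)
          then show ?thesis by blast
        qed
      qed
    qed
    then show ?case using Cons finite_subset by auto
  qed
  obtain xs ys where "xs \<in> lists I" "wp xs = v" "ys \<in> lists I" "wp ys = w"
    using word_exists assms by metis
  then have "finite (separating \<one> v \<union> separating \<one> w)" using * by auto
  moreover have "separating v w \<subseteq> separating \<one> v \<union> separating \<one> w"
    by (auto simp: separating_def)
  ultimately show ?thesis using finite_subset by blast
qed

text \<open>A descent \<open>i\<close> of \<open>v \<otimes> inv w\<close> yields the separating
  root \<open>act (inv w) (simple_root i)\<close>: \<open>w\<close> makes it simple, while
  \<open>v\<close> makes it negative.\<close>

lemma separating_empty:
  assumes "v \<in> carrier W" "w \<in> carrier W" "separating v w = {}"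
  shows "v = w"
proof (rule ccontr)
  let ?x = "v \<otimes> inv w"
  assume "v \<noteq> w"
  moreover have "?x \<otimes> w = v" using assms by (simp add: m_assoc)
  ultimately have x: "?x \<in> carrier W" "?x \<noteq> \<one>" using assms by auto
  then obtain i where i: "i \<in> I" "len ?x = Suc (len (?x \<otimes> s i))"
    using len_descent_exists[OF x] by blast
  let ?y = "?x \<otimes> s i"
  have y: "?y \<in> carrier W" "?y \<otimes> s i = ?x"
    using x(1) i(1) by (simp_all only: mult_gen_gen m_closed gen_closed)
  have "act ?y (simple_root i) \<in> pos_roots"
    unfolding pos_roots_def
    using act_simple_nonneg[OF y(1) i(1)] i(2) y(2) act_in_roots[OF y(1) simple_root_in_roots[OF i(1)]]
    by simp
  then have "act ?x (simple_root i) \<notin> pos_roots"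
    using act_gen_simple[OF y(1) i(1)] y(2) not_pos_and_neg by simp
  then have "v \<notin> half_space (act (inv w) (simple_root i))"
    using assms by (auto simp: half_space_iff act_mult)
  moreover have "w \<in> half_space (act (inv w) (simple_root i))"
    using assms i by (simp add: half_space_iff simple_root_pos)
  moreover have "act (inv w) (simple_root i) \<in> roots"
    using assms i act_in_roots simple_root_in_roots by blast
  ultimately show False using assms by (auto simp: separating_def)
qed

text \<open>Only the constraints already satisfied at \<open>u\<close> are imposed. This is the set
  in which the toggles trap the orbit of \<open>u\<close>.\<close>

definition region :: "'g set \<Rightarrow> 'g \<Rightarrow> 'g set" where
  "region L u = {w \<in> carrier W. \<forall>\<beta> \<in> root_constraints L. u \<in> half_space \<beta> \<longrightarrow> w \<in> half_space \<beta>}"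

text \<open>Off the finite set \<open>F\<close>, the point \<open>u\<close> and all of
  \<open>L\<close> lie on the same side as \<open>v\<close>. Such a root or its negative is then a
  constraint satisfied at \<open>u\<close>, hence on the whole region. So an element of the region
  is separated from \<open>v\<close> only by roots in \<open>F\<close>, and these roots determine
  it.\<close>

lemma finite_region:
  assumes "finite L" "L \<noteq> {}" "L \<subseteq> carrier W" "u \<in> carrier W"
  shows "finite (region L u)"
proof -
  obtain v where v: "v \<in> L" using assms by blast
  have vc: "v \<in> carrier W" using v assms by blast
  define F where "F = separating v u \<union> (\<Union>v'\<in>L. separating v v')"
  have "finite F"
    unfolding F_def using assms vc by (auto intro!: finite_separating)
  have "separating v w \<subseteq> F" if w: "w \<in> region L u" for w
  proof
    fix \<beta> assume b: "\<beta> \<in> separating v w"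
    then have r: "\<beta> \<in> roots" by (simp add: separating_def)
    have wc: "w \<in> carrier W" using w by (simp add: region_def)
    show "\<beta> \<in> F"
    proof (rule ccontr)
      assume "\<beta> \<notin> F"
      then have eq: "v \<in> half_space \<beta> \<longleftrightarrow> u \<in> half_space \<beta>"
        "\<And>v'. v' \<in> L \<Longrightarrow> v \<in> half_space \<beta> \<longleftrightarrow> v' \<in> half_space \<beta>"
        using r unfolding F_def separating_def by blast+
      show False
      proof (cases "v \<in> half_space \<beta>")
        case True
        then have "\<beta> \<in> root_constraints L" using eq r by (auto simp: root_constraints_def)
        then show False using w eq True b by (auto simp: region_def separating_def)
      next
        case False
        let ?\<gamma> = "\<lambda>j. - \<beta> j"
        have g: "x \<in> half_space ?\<gamma> \<longleftrightarrow> x \<notin> half_space \<beta>" if "x \<in> carrier W" for x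
          using half_space_uminus that r by blast
        have "?\<gamma> \<in> root_constraints L"
          using eq r uminus_in_roots g False assms(3) by (auto simp: root_constraints_def)
        then show False using w eq False b g assms(4) wc by (auto simp: region_def separating_def)
      qed
    qed
  qed
  then have "separating v ` region L u \<subseteq> Pow F" by blast
  moreover have "inj_on (separating v) (region L u)"
  proof (rule inj_onI)
    fix x y assume xy: "x \<in> region L u" "y \<in> region L u" "separating v x = separating v y"
    then have "separating x y = {}" unfolding separating_def by blast
    then show "x = y" using separating_empty xy by (auto simp: region_def)
  qed
  ultimately show ?thesis using \<open>finite F\<close> by (meson finite_Pow_iff inj_on_finite)
qed

lemma self_in_region: "u \<in> carrier W \<Longrightarrow> u \<in> region L u"
  by (simp add: region_def)

section \<open>Toggles\<close>

text \<open>The only half-space that a move could leave belongs to the tested root, and if that root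
  is a constraint the toggle stays put.\<close>

lemma toggle_region:
  assumes "i \<in> I" "w \<in> region L u"
  shows "toggle L i w \<in> region L u"
proof (cases "act (inv w) (simple_root i) \<in> root_constraints L")
  case True
  then show ?thesis using assms by (simp add: toggle_def)
next
  case False
  have "w \<in> carrier W" using assms by (simp add: region_def)
  then have "s i \<otimes> w \<in> half_space \<beta>" if "\<beta> \<in> root_constraints L" "u \<in> half_space \<beta>" for \<beta>
    using half_space_cross[of w i \<beta>] assms that False by (auto simp: region_def)
  then show ?thesis
    using False assms gen_closed by (auto simp: toggle_def region_def)
qed

lemma foldr_toggle_region:
  assumes "xs \<in> lists I" "w \<in> region L u"
  shows "foldr (toggle L) xs w \<in> region L u"
  using assms by (induction xs) (auto intro: toggle_region)

lemma foldr_toggle_closed: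
  assumes "xs \<in> lists I" "w \<in> carrier W"
  shows "foldr (toggle L) xs w \<in> carrier W"
  using foldr_toggle_region[OF assms(1) self_in_region[OF assms(2)]] by (simp add: region_def)

text \<open>The roots cutting out \<open>L\<close> are themselves constraints, all satisfied at
  \<open>u\<close>. Hence an orbit that has entered \<open>L\<close> remains there.\<close>

lemma convex_region:
  assumes "convex_subset L" "u \<in> L"
  shows "region L u = L"
proof
  obtain A where A: "A \<subseteq> roots" "L = carrier W \<inter> (\<Inter>\<beta>\<in>A. half_space \<beta>)"
    using assms unfolding convex_subset_def by blast
  then have "A \<subseteq> root_constraints L" by (auto simp: root_constraints_def)
  then have "\<forall>\<beta>\<in>A. \<beta> \<in> root_constraints L \<and> u \<in> half_space \<beta>" using A assms by blast
  then have "region L u \<subseteq> carrier W \<inter> (\<Inter>\<beta>\<in>A. half_space \<beta>)"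
    unfolding region_def by blast
  then show "region L u \<subseteq> L" using A by simp
  show "L \<subseteq> region L u" using A(2) by (auto simp: region_def root_constraints_def)
qed

text \<open>For \<^term>\<open>u \<in> L\<close> the region is the convex hull of \<^term>\<open>L\<close>.\<close>

lemma region_convex:
  assumes "L \<subseteq> carrier W" "u \<in> L"
  shows "convex_subset (region L u)"
proof -
  have "root_constraints L \<subseteq> roots" by (auto simp: root_constraints_def)
  moreover have "region L u = carrier W \<inter> (\<Inter>\<beta>\<in>root_constraints L. half_space \<beta>)"
    using assms by (auto simp: region_def root_constraints_def)
  ultimately show ?thesis unfolding convex_subset_def by blast
qed

lemma subset_region: "L \<subseteq> carrier W \<Longrightarrow> L \<subseteq> region L u"
  by (auto simp: region_def root_constraints_def)

text \<open>A smaller set has more constraints, and all of them hold at its element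
  \<open>u\<close>.\<close>

lemma region_mono:
  assumes "T \<subseteq> L" "u \<in> T"
  shows "region T u \<subseteq> region L u"
  using assms by (auto simp: region_def root_constraints_def)

text \<open>A toggle that tests a constraint of \<open>L\<close> also fixes the point for every
  subset of \<open>L\<close>. A toggle that tests any other root needs just one element of
  \<open>L\<close> outside the half-space, so each letter adds at most one witness to
  \<open>T\<close>.\<close>

lemma foldr_toggle_finite_support:
  assumes "xs \<in> lists I" "u \<in> carrier W"
  shows "\<exists>T. finite T \<and> T \<subseteq> L \<and>
    (\<forall>L'. T \<subseteq> L' \<and> L' \<subseteq> L \<longrightarrow> foldr (toggle L') xs u = foldr (toggle L) xs u)"
  using assms(1)
proof (induction xs)
  case (Cons i xs)
  then have i: "i \<in> I" and xs: "xs \<in> lists I" by auto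
  from Cons.IH obtain T where T: "finite T" "T \<subseteq> L"
    "\<forall>L'. T \<subseteq> L' \<and> L' \<subseteq> L \<longrightarrow> foldr (toggle L') xs u = foldr (toggle L) xs u"
    by (elim exE conjE) (rule that)
  define w where "w = foldr (toggle L) xs u"
  have Tw: "foldr (toggle L') xs u = w" if "T \<subseteq> L'" "L' \<subseteq> L" for L'
    using T(3) that unfolding w_def by blast
  have w: "w \<in> carrier W" unfolding w_def using foldr_toggle_closed xs assms(2) by blast
  define \<beta> where "\<beta> = act (inv w) (simple_root i)"
  have b: "\<beta> \<in> roots"
    unfolding \<beta>_def using i w by (simp add: act_in_roots simple_root_in_roots)
  show ?case
  proof (cases "\<beta> \<in> root_constraints L")
    case True
    then have "\<beta> \<in> root_constraints L'" if "L' \<subseteq> L" for L'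
      using that by (auto simp: root_constraints_def)
    then have tog: "toggle L' i w = toggle L i w" if "L' \<subseteq> L" for L'
      using that True by (simp add: toggle_def \<beta>_def)
    have "foldr (toggle L') (i # xs) u = foldr (toggle L) (i # xs) u"
      if "T \<subseteq> L'" "L' \<subseteq> L" for L'
      using Tw[OF that] tog[OF that(2)] by (simp add: w_def[symmetric])
    then show ?thesis using T(1,2) by blast
  next
    case False
    then obtain x where x: "x \<in> L" "x \<notin> half_space \<beta>"
      using b by (auto simp: root_constraints_def)
    then have "\<beta> \<notin> root_constraints L'" if "x \<in> L'" for L'
      using that by (auto simp: root_constraints_def)
    then have tog: "toggle L' i w = toggle L i w" if "x \<in> L'" for L'
      using that False by (simp add: toggle_def \<beta>_def)
    have "foldr (toggle L') (i # xs) u = foldr (toggle L) (i # xs) u"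
      if "insert x T \<subseteq> L'" "L' \<subseteq> L" for L'
      using Tw[of L'] tog[of L'] that by (simp add: w_def[symmetric])
    then show ?thesis using T(1,2) x(1) by (intro exI[of _ "insert x T"]) blast
  qed
qed auto

section \<open>Promotion\<close>

text \<open>One word serves all \<open>L\<close> at once, which allows promotions for different
  convex sets to be compared.\<close>

lemma Pro_word:
  assumes "coxeter_element c"
  obtains xs where "xs \<in> lists I" "\<And>L. Pro c L = foldr (toggle L) xs"
proof -
  define xs where "xs = (SOME xs. coxeter_word c xs)"
  have "coxeter_word c xs"
    using assms unfolding xs_def coxeter_element_def by (rule someI_ex)
  then show ?thesis
    using that[of xs] by (auto simp: Pro_def xs_def coxeter_word_def)
qed

lemma funpow_foldr: "foldr f xs ^^ n = foldr f (concat (replicate n xs))"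
  by (induction n) (auto simp: fun_eq_iff)

lemma Pro_funpow_word:
  assumes "coxeter_element c"
  shows "\<exists>ys\<in>lists I. \<forall>L. Pro c L ^^ K = foldr (toggle L) ys"
proof -
  obtain xs where "xs \<in> lists I" "\<And>L. Pro c L = foldr (toggle L) xs"
    using Pro_word assms by blast
  moreover from this(1) have "concat (replicate K xs) \<in> lists I"
    by (induction K) auto
  ultimately show ?thesis
    by (metis funpow_foldr)
qed

lemma Pro_funpow_region:
  assumes "coxeter_element c" "w \<in> region L u"
  shows "(Pro c L ^^ n) w \<in> region L u"
  using Pro_funpow_word[OF assms(1)] foldr_toggle_region assms(2) by metis

lemma convex_closed: "convex_subset L \<Longrightarrow> L \<subseteq> carrier W"
  by (auto simp: convex_subset_def)

lemma superheavy_imp_heavy: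
  assumes "coxeter_element c" "convex_subset L" "superheavy c L"
  shows "heavy c L"
  unfolding heavy_def
proof (intro ballI impI, elim exE conjE)
  fix u K assume u: "u \<in> carrier W" "K \<ge> 1" "(Pro c L ^^ K) u = u"
  obtain n where n: "(Pro c L ^^ n) u \<in> L" using assms u unfolding superheavy_def by blast
  \<comment> \<open>Since \<open>K \<ge> 1\<close>, the orbit can be continued inside
    \<open>L\<close> from time \<open>n\<close> to time \<open>K * n\<close>, a multiple of the
    period, where it is back at \<open>u\<close>.\<close>
  have "(Pro c L ^^ (K * n - n)) ((Pro c L ^^ n) u) \<in> L"
    using Pro_funpow_region[OF assms(1)] convex_region[OF assms(2) n] n by metis
  then have "(Pro c L ^^ (K * n)) u \<in> L"
    using u(2) by (simp flip: funpow_add[THEN fun_cong, simplified])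
  moreover have "(Pro c L ^^ (K * n)) u = u"
    using u(3) by (simp add: funpow_mult[symmetric]) (induction n; simp)
  ultimately show "u \<in> L" by simp
qed

lemma heavy_imp_superheavy:
  assumes "coxeter_element c" "convex_subset L" "finite L" "L \<noteq> {}" "heavy c L"
  shows "superheavy c L"
  unfolding superheavy_def
proof
  fix u assume u: "u \<in> carrier W"
  have "finite (region L u)" using finite_region convex_closed assms u by blast
  moreover have orb: "(Pro c L ^^ n) u \<in> region L u" for n
    using Pro_funpow_region assms self_in_region u by blast
  ultimately obtain n K where "K \<ge> 1" "(Pro c L ^^ K) ((Pro c L ^^ n) u) = (Pro c L ^^ n) u"
    by (rule funpow_orbit_finite_periodic)
  moreover have "(Pro c L ^^ n) u \<in> carrier W" using orb by (auto simp: region_def)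
  ultimately show "\<exists>n. (Pro c L ^^ n) u \<in> L" using assms(5) unfolding heavy_def by blast
qed

text \<open>A periodic orbit tests only finitely many roots, so it is also an orbit for the convex hull
  of finitely many elements witnessing the outcome of these tests.\<close>

lemma heavy_of_finite_heavy:
  assumes "coxeter_element c" "convex_subset L" "L \<noteq> {}"
    and fin: "\<And>L'. L' \<noteq> {} \<Longrightarrow> finite L' \<Longrightarrow> convex_subset L' \<Longrightarrow> heavy c L'"
  shows "heavy c L"
  unfolding heavy_def
proof (intro ballI impI, elim exE conjE)
  fix u K assume u: "u \<in> carrier W" "(K::nat) \<ge> 1" "(Pro c L ^^ K) u = u"
  obtain ys where ys: "ys \<in> lists I" "\<And>L. Pro c L ^^ K = foldr (toggle L) ys"
    using Pro_funpow_word[OF assms(1), of K] by blast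
  from foldr_toggle_finite_support[OF ys(1) u(1), of L]
  obtain T where T: "finite T" "T \<subseteq> L"
    "\<forall>L'. T \<subseteq> L' \<and> L' \<subseteq> L \<longrightarrow> foldr (toggle L') ys u = foldr (toggle L) ys u"
    by (elim exE conjE) (rule that)
  \<comment> \<open>\<open>T\<close> may be empty. An additional point of \<open>L\<close> makes the
    hull nonempty and serves as its base point.\<close>
  obtain v where v: "v \<in> L" using assms by blast
  let ?T = "insert v T"
  let ?L = "region ?T v"
  have Lc: "?T \<subseteq> L" "?T \<subseteq> carrier W" using T v convex_closed assms by auto
  have sub: "?T \<subseteq> ?L" using subset_region Lc by blast
  have sub': "?L \<subseteq> L" using region_mono[OF Lc(1)] convex_region[OF assms(2) v] by auto
  have "heavy c ?L"
    using sub Lc T by (intro fin finite_region region_convex) auto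
  moreover have "(Pro c ?L ^^ K) u = u"
    using u(3) T(3) sub sub' ys(2) by simp
  ultimately have "u \<in> ?L" using u unfolding heavy_def by blast
  then show "u \<in> L" using sub' by blast
qed

end

theorem proposition1p8:
  fixes W :: "('g, 'b) monoid_scheme" and I :: "'i set" and s :: "'i \<Rightarrow> 'g" and c :: 'g
  assumes "coxeter_system W I s"
    and "coxeter_system.coxeter_element W I s c"
  shows "((\<forall>L. L \<noteq> {} \<and> coxeter_system.convex_subset W I s L
              \<longrightarrow> coxeter_system.heavy W I s c L)
          \<longleftrightarrow> (\<forall>L. L \<noteq> {} \<and> finite L \<and> coxeter_system.convex_subset W I s L
              \<longrightarrow> coxeter_system.heavy W I s c L))
       \<and> ((\<forall>L. L \<noteq> {} \<and> finite L \<and> coxeter_system.convex_subset W I s L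
              \<longrightarrow> coxeter_system.heavy W I s c L)
          \<longleftrightarrow> (\<forall>L. L \<noteq> {} \<and> finite L \<and> coxeter_system.convex_subset W I s L
              \<longrightarrow> coxeter_system.superheavy W I s c L))"
proof -
  interpret coxeter_system W I s by (fact assms(1))
  show ?thesis
    using heavy_of_finite_heavy[OF assms(2)] heavy_imp_superheavy[OF assms(2)]
      superheavy_imp_heavy[OF assms(2)] by meson
qed

end
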